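(* Let $\mathcal{S}=\langle\mathcal{L},\vdash\rangle$ be a logic. If pfECQ3 holds in $\mathcal{S}$, then spECQ holds in $\mathcal{S}$. Conversely, if $\mathcal{L}$ has at least two distinct elements and spECQ holds in $\mathcal{S}$, then pfECQ3 holds in $\mathcal{S}$. Thus, if $\mathcal{L}$ has at least two distinct elements, pfECQ3 and spECQ are equivalent.
   Context: A logic is a pair $\langle\mathcal{L},\vdash\rangle$ with $\mathcal{L}$ a set and $\vdash\,\subseteq\mathcal{P}(\mathcal{L})\times\mathcal{L}$; $C_\vdash(\Gamma)=\{\alpha:\Gamma\vdash\alpha\}$. spECQ: for every $\Gamma\subsetneq\mathcal{L}$ there is $\alpha\in\mathcal{L}$ with $\Gamma\cup\{\alpha\}\subsetneq\mathcal{L}$ and $C_\vdash(\Gamma\cup\{\alpha\})=\mathcal{L}$. pfECQ3: for every $\Gamma\subsetneq\mathcal{L}$ there is $\Delta$ with $\emptyset\neq\Delta\subsetneq\mathcal{L}$, $\Gamma\cup\Delta\subsetneq\mathcal{L}$, and $C_\vdash(\Gamma\cup\Delta')=\mathcal{L}$ for every nonempty $\Delta'\subseteq\Delta$. *)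

theory Defs
  imports Main
begin

definition is_logic :: "'a set \<Rightarrow> ('a set \<times> 'a) set \<Rightarrow> bool" where
  "is_logic L E \<longleftrightarrow> E \<subseteq> Pow L \<times> L"

definition Cn :: "('a set \<times> 'a) set \<Rightarrow> 'a set \<Rightarrow> 'a set" where
  "Cn E \<Gamma> = {\<alpha>. (\<Gamma>, \<alpha>) \<in> E}"

definition spECQ :: "'a set \<Rightarrow> ('a set \<times> 'a) set \<Rightarrow> bool" where
  "spECQ L E \<longleftrightarrow>
     (\<forall>\<Gamma>. \<Gamma> \<subset> L \<longrightarrow>
        (\<exists>\<alpha>\<in>L. \<Gamma> \<union> {\<alpha>} \<subset> L \<and> Cn E (\<Gamma> \<union> {\<alpha>}) = L))"

definition pfECQ3 :: "'a set \<Rightarrow> ('a set \<times> 'a) set \<Rightarrow> bool" where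
  "pfECQ3 L E \<longleftrightarrow>
     (\<forall>\<Gamma>. \<Gamma> \<subset> L \<longrightarrow>
        (\<exists>\<Delta>. \<Delta> \<noteq> {} \<and> \<Delta> \<subset> L \<and> \<Gamma> \<union> \<Delta> \<subset> L \<and>
           (\<forall>\<Delta>'. \<Delta>' \<noteq> {} \<and> \<Delta>' \<subseteq> \<Delta> \<longrightarrow> Cn E (\<Gamma> \<union> \<Delta>') = L)))"

end

theory Submission
  imports Defs
begin

text \<open>Singletons link the two principles. If \<Delta> is a pfECQ3 witness for \<Gamma>, any
  \<alpha> \<in> \<Delta> is an spECQ witness, since {\<alpha>} is among the nonempty subsets of
  \<Delta> that explode with \<Gamma>. Conversely, an spECQ witness \<alpha> yields \<Delta> =
  {\<alpha>}, for which quantifying over nonempty subsets says no more than the single instance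
  {\<alpha>}.\<close>

lemma pfECQ3_imp_spECQ:
  assumes "pfECQ3 L E"
  shows "spECQ L E"
  unfolding spECQ_def
proof (intro allI impI)
  fix \<Gamma> assume "\<Gamma> \<subset> L"
  with assms obtain \<Delta> where \<Delta>: "\<Delta> \<noteq> {}" "\<Gamma> \<union> \<Delta> \<subset> L"
    and Cn: "\<And>\<Delta>'. \<Delta>' \<noteq> {} \<Longrightarrow> \<Delta>' \<subseteq> \<Delta> \<Longrightarrow> Cn E (\<Gamma> \<union> \<Delta>') = L"
    unfolding pfECQ3_def by meson
  from \<Delta>(1) obtain \<alpha> where \<alpha>: "\<alpha> \<in> \<Delta>" by blast
  have "Cn E (\<Gamma> \<union> {\<alpha>}) = L" using \<alpha> by (intro Cn) auto
  \<comment> \<open>Properness passes down from \<Gamma> \<union> \<Delta>: an element of L missed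
    by it is also missed by the smaller set \<Gamma> \<union> {\<alpha>}.\<close>
  moreover have "\<alpha> \<in> L" "\<Gamma> \<union> {\<alpha>} \<subset> L" using \<alpha> \<Delta>(2) by blast+
  ultimately show "\<exists>\<alpha>\<in>L. \<Gamma> \<union> {\<alpha>} \<subset> L \<and> Cn E (\<Gamma> \<union> {\<alpha>}) = L" by blast
qed

lemma spECQ_imp_pfECQ3:
  assumes "spECQ L E"
  shows "pfECQ3 L E"
  unfolding pfECQ3_def
proof (intro allI impI)
  fix \<Gamma> assume "\<Gamma> \<subset> L"
  with assms obtain \<alpha> where \<alpha>: "\<Gamma> \<union> {\<alpha>} \<subset> L" "Cn E (\<Gamma> \<union> {\<alpha>}) = L"
    unfolding spECQ_def by meson
  \<comment> \<open>The properness that pfECQ3 demands of \<Delta> itself comes from that of the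
    larger set \<Gamma> \<union> {\<alpha>}.\<close>
  have "{\<alpha>} \<subset> L" using \<alpha>(1) by blast
  moreover have "Cn E (\<Gamma> \<union> \<Delta>') = L" if "\<Delta>' \<noteq> {} \<and> \<Delta>' \<subseteq> {\<alpha>}" for \<Delta>'
  proof -
    have "\<Delta>' = {\<alpha>}" using that by blast
    with \<alpha>(2) show ?thesis by simp
  qed
  ultimately show "\<exists>\<Delta>. \<Delta> \<noteq> {} \<and> \<Delta> \<subset> L \<and> \<Gamma> \<union> \<Delta> \<subset> L \<and>
      (\<forall>\<Delta>'. \<Delta>' \<noteq> {} \<and> \<Delta>' \<subseteq> \<Delta> \<longrightarrow> Cn E (\<Gamma> \<union> \<Delta>') = L)"
    using \<alpha>(1) by (intro exI[of _ "{\<alpha>}"]) simp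
qed

theorem theorem3p17:
  fixes L :: "'a set" and E :: "('a set \<times> 'a) set"
  assumes "is_logic L E"
  shows "(pfECQ3 L E \<longrightarrow> spECQ L E) \<and>
    ((\<exists>x\<in>L. \<exists>y\<in>L. x \<noteq> y) \<longrightarrow> spECQ L E \<longrightarrow> pfECQ3 L E) \<and>
    ((\<exists>x\<in>L. \<exists>y\<in>L. x \<noteq> y) \<longrightarrow> (pfECQ3 L E \<longleftrightarrow> spECQ L E))"
  using pfECQ3_imp_spECQ spECQ_imp_pfECQ3 by blast

end
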